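(* Let $n\geq 3$ and $2\leq k\leq\binom{n}{2}$, and let $p,q,r$ be the integers with $k\binom{p}{2}\leq\binom{n}{2}<k\binom{p+1}{2}$, $\binom{n}{2}=k\binom{p}{2}+qp+r$, $0\leq q<k$, $0\leq r<p$. Suppose $M(k,n)$ is attained by a packing of Type 1 or Type 2, where in the case of Type 2 with $r\geq(p-1)/2$ the non-complete member $G\in\mathcal{F}_{p,r}$ of the packing satisfies $\omega(G)=p$. Then $$\omega(k,n)=\chi(k,n)=\mathrm{ch}(k,n)=\mathrm{col}(k,n)=\lfloor M(k,n)\rfloor+k$$ and $$\kappa^*(k,n)=\lambda^*(k,n)=\delta^*(k,n)=\lfloor M(k,n)\rfloor.$$
   Context: For a finite graph $G$, $\mathrm{Mad}(G)=\max\{2e(H)/|V(H)| : H\subseteq G,\ |V(H)|\geq 1\}$. For a graph parameter $\mathfrak{p}$, $\mathfrak{p}(k,n)$ is the maximum of $\sum_{i=1}^k\mathfrak{p}(G_i)$ over all partitions of $E(K_n)$ into $k$ spanning subgraphs $G_1,\dots,G_k$; $M(k,n)$ is this for $\mathfrak{p}=\mathrm{Mad}$. Parameters: $\omega$ clique number; $\chi$ chromatic number; $\mathrm{ch}$ choice (list chromatic) number; $\delta^*(G)$ degeneracy, i.e. $\max\delta(H)$ over induced subgraphs $H$; $\mathrm{col}(G)=\delta^*(G)+1$; $\kappa^*(G)$ (resp. $\lambda^*(G)$) the maximum vertex (resp. edge) connectivity of an induced subgraph of $G$. For $0<r<p$ and $m=\binom{p}{2}+r$, $\mathcal{F}_{p,r}$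 is: the graphs with $m$ edges containing $K_p$, if $r<(p-1)/2$; the graphs with $m$ edges containing $K_p$ or having exactly $p+1$ vertices, if $r=(p-1)/2$; the graphs with $m$ edges and exactly $p+1$ vertices, if $r>(p-1)/2$. "$M(k,n)$ is attained by a packing of Type 1" means ($r=0$ and) $K_n$ has an edge decomposition, ignoring isolated vertices, into $q$ copies of $K_{p+1}$ and $k-q$ copies of $K_p$, whose $\mathrm{Mad}$ values sum to $M(k,n)$; "Type 2" means ($0<r<p$ and) $K_n$ has an edge decomposition into $q$ copies of $K_{p+1}$, $k-q-1$ copies of $K_p$ and one graph $G\in\mathcal{F}_{p,r}$, whose $\mathrm{Mad}$ values sum to $M(k,n)$. *)

theory Defs
  imports Complex_Main "HOL-Library.Disjoint_Sets"
begin

type_synonym 'a graph = "'a set \<times> 'a set set"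

abbreviation verts :: "'a graph \<Rightarrow> 'a set" where
  "verts \<equiv> fst"

abbreviation edges :: "'a graph \<Rightarrow> 'a set set" where
  "edges \<equiv> snd"

definition pairs :: "'a set \<Rightarrow> 'a set set" where
  "pairs S = {e. e \<subseteq> S \<and> card e = 2}"

definition fin_graph :: "'a graph \<Rightarrow> bool" where
  "fin_graph G \<longleftrightarrow> finite (verts G) \<and> edges G \<subseteq> pairs (verts G)"

definition complete_graph :: "nat \<Rightarrow> nat graph" where
  "complete_graph n = ({..<n}, pairs {..<n})"

definition subgraph :: "'a graph \<Rightarrow> 'a graph \<Rightarrow> bool" where
  "subgraph H G \<longleftrightarrow> fin_graph H \<and> verts H \<subseteq> verts G \<and> edges H \<subseteq> edges G"

definition induced :: "'a graph \<Rightarrow> 'a set \<Rightarrow> 'a graph" where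
  "induced G S = (S, {e \<in> edges G. e \<subseteq> S})"

definition drop_isolated :: "'a graph \<Rightarrow> 'a graph" where
  "drop_isolated G = ({v \<in> verts G. \<exists>e \<in> edges G. v \<in> e}, edges G)"

definition connected_graph :: "'a graph \<Rightarrow> bool" where
  "connected_graph G \<longleftrightarrow>
     (\<forall>u \<in> verts G. \<forall>v \<in> verts G. (\<lambda>x y. {x, y} \<in> edges G)\<^sup>*\<^sup>* u v)"


definition Mad :: "'a graph \<Rightarrow> real" where
  "Mad G = Max {2 * real (card (edges H)) / real (card (verts H)) | H.
                  subgraph H G \<and> card (verts H) \<ge> 1}"

definition is_clique :: "'a graph \<Rightarrow> 'a set \<Rightarrow> bool" where
  "is_clique G S \<longleftrightarrow> S \<subseteq> verts G \<and> pairs S \<subseteq> edges G"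

definition clique_number :: "'a graph \<Rightarrow> nat" where
  "clique_number G = Max {card S | S. is_clique G S}"

definition proper_coloring :: "'a graph \<Rightarrow> ('a \<Rightarrow> nat) \<Rightarrow> bool" where
  "proper_coloring G f \<longleftrightarrow>
     (\<forall>u \<in> verts G. \<forall>v \<in> verts G. u \<noteq> v \<and> {u, v} \<in> edges G \<longrightarrow> f u \<noteq> f v)"

definition chromatic_number :: "'a graph \<Rightarrow> nat" where
  "chromatic_number G = (LEAST c. \<exists>f. proper_coloring G f \<and> (\<forall>v \<in> verts G. f v < c))"

definition choosable :: "'a graph \<Rightarrow> nat \<Rightarrow> bool" where
  "choosable G c \<longleftrightarrow>
     (\<forall>L :: 'a \<Rightarrow> nat set. (\<forall>v \<in> verts G. finite (L v) \<and> card (L v) = c) \<longrightarrow>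
        (\<exists>f. proper_coloring G f \<and> (\<forall>v \<in> verts G. f v \<in> L v)))"

definition choice_number :: "'a graph \<Rightarrow> nat" where
  "choice_number G = (LEAST c. choosable G c)"

definition vdegree :: "'a graph \<Rightarrow> 'a \<Rightarrow> nat" where
  "vdegree G v = card {e \<in> edges G. v \<in> e}"

definition min_degree :: "'a graph \<Rightarrow> nat" where
  "min_degree G = Min (vdegree G ` verts G)"

text \<open>
  Vertex connectivity is the least number of vertices whose deletion leaves a disconnected
  graph or a single vertex, so a complete graph on \<open>m\<close> vertices has connectivity \<open>m - 1\<close>.
  Both connectivities of a one-vertex graph are 0.
\<close>

definition vertex_connectivity :: "'a graph \<Rightarrow> nat" where
  "vertex_connectivity G =
     Min {card X | X. X \<subset> verts G \<and>
            (\<not> connected_graph (induced G (verts G - X)) \<or> card (verts G - X) = 1)}"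

definition edge_connectivity :: "'a graph \<Rightarrow> nat" where
  "edge_connectivity G =
     (if card (verts G) \<le> 1 then 0
      else Min {card F | F. F \<subseteq> edges G \<and> \<not> connected_graph (verts G, edges G - F)})"

definition max_induced :: "('a graph \<Rightarrow> nat) \<Rightarrow> 'a graph \<Rightarrow> nat" where
  "max_induced f G = Max {f (induced G S) | S. S \<subseteq> verts G \<and> S \<noteq> {}}"

definition degeneracy :: "'a graph \<Rightarrow> nat" where
  "degeneracy = max_induced min_degree"

definition coloring_number :: "'a graph \<Rightarrow> nat" where
  "coloring_number G = degeneracy G + 1"

definition kappa_star :: "'a graph \<Rightarrow> nat" where
  "kappa_star = max_induced vertex_connectivity"

definition lambda_star :: "'a graph \<Rightarrow> nat" where
  "lambda_star = max_induced edge_connectivity"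


definition edge_partition :: "nat \<Rightarrow> nat \<Rightarrow> (nat \<Rightarrow> nat graph) \<Rightarrow> bool" where
  "edge_partition k n G \<longleftrightarrow>
     (\<forall>i<k. verts (G i) = {..<n}) \<and>
     disjoint_family_on (\<lambda>i. edges (G i)) {..<k} \<and>
     (\<Union>i<k. edges (G i)) = edges (complete_graph n)"

definition param_max ::
  "(nat graph \<Rightarrow> 'b::{linorder,comm_monoid_add}) \<Rightarrow> nat \<Rightarrow> nat \<Rightarrow> 'b" where
  "param_max f k n = Max {(\<Sum>i<k. f (G i)) | G. edge_partition k n G}"


definition copy_of_complete :: "nat \<Rightarrow> 'a graph \<Rightarrow> bool" where
  "copy_of_complete m G \<longleftrightarrow> finite (verts G) \<and> card (verts G) = m \<and> edges G = pairs (verts G)"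

definition contains_complete :: "nat \<Rightarrow> 'a graph \<Rightarrow> bool" where
  "contains_complete m G \<longleftrightarrow> (\<exists>H. subgraph H G \<and> copy_of_complete m H)"

definition F_family :: "nat \<Rightarrow> nat \<Rightarrow> 'a graph set" where
  "F_family p r =
     {G. fin_graph G \<and> card (edges G) = (p choose 2) + r \<and>
         (if real r < (real p - 1) / 2 then contains_complete p G
          else if real r = (real p - 1) / 2 then contains_complete p G \<or> card (verts G) = p + 1
          else card (verts G) = p + 1)}"

definition type1_packing ::
  "nat \<Rightarrow> nat \<Rightarrow> nat \<Rightarrow> nat \<Rightarrow> nat \<Rightarrow> (nat \<Rightarrow> nat graph) \<Rightarrow> bool" where
  "type1_packing k n p q r G \<longleftrightarrow>
     r = 0 \<and> edge_partition k n G \<and>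
     (\<exists>Q \<subseteq> {..<k}. card Q = q \<and>
        (\<forall>i \<in> Q. copy_of_complete (p + 1) (drop_isolated (G i))) \<and>
        (\<forall>i \<in> {..<k} - Q. copy_of_complete p (drop_isolated (G i))))"

text \<open>The index \<open>j\<close> marks the member of the packing that comes from \<open>F_family p r\<close>.\<close>

definition type2_packing ::
  "nat \<Rightarrow> nat \<Rightarrow> nat \<Rightarrow> nat \<Rightarrow> nat \<Rightarrow> (nat \<Rightarrow> nat graph) \<Rightarrow> nat \<Rightarrow> bool" where
  "type2_packing k n p q r G j \<longleftrightarrow>
     0 < r \<and> r < p \<and> edge_partition k n G \<and> j < k \<and>
     drop_isolated (G j) \<in> F_family p r \<and>
     (\<exists>Q \<subseteq> {..<k} - {j}. card Q = q \<and>
        (\<forall>i \<in> Q. copy_of_complete (p + 1) (drop_isolated (G i))) \<and>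
        (\<forall>i \<in> {..<k} - {j} - Q. copy_of_complete p (drop_isolated (G i))))"

end

theory Submission imports Defs begin

text \<open>
  Every graph with at least one vertex satisfies \<open>\<omega> - 1 \<le> \<kappa>* \<le> \<delta>* \<le> Mad\<close>,
  \<open>\<omega> - 1 \<le> \<lambda>* \<le> \<delta>*\<close> and \<open>\<omega> \<le> \<chi> \<le> ch \<le> \<delta>* + 1\<close>. Hence over any partition the
  values of \<open>\<kappa>*\<close>, \<open>\<lambda>*\<close>, \<open>\<delta>*\<close>, and of the other parameters minus 1, sum to at most \<open>\<lfloor>M(k,n)\<rfloor>\<close>.
  In the given packing every complete member has \<open>Mad = \<omega> - 1\<close>, while the exceptional member
  has fewer than \<open>(p + 1 choose 2)\<close> edges, so \<open>Mad < p \<le> \<omega>\<close>. Thus the sum of \<open>\<omega> - 1\<close> over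
  the packing exceeds \<open>M(k,n) - 1\<close>, and all the bounds are attained by this one packing.
\<close>

section \<open>Finite graphs\<close>

lemma finite_pairs: "finite S \<Longrightarrow> finite (pairs S)"
  unfolding pairs_def by (rule finite_subset[of _ "Pow S"]) auto

lemma card_pairs: "finite S \<Longrightarrow> card (pairs S) = card S choose 2"
  unfolding pairs_def by (rule n_subsets)

lemma doubleton_in_pairs: "{u, v} \<in> pairs S \<longleftrightarrow> u \<in> S \<and> v \<in> S \<and> u \<noteq> v"
  by (auto simp: pairs_def card_insert_if)

lemma fin_graph_finite_edges: "fin_graph G \<Longrightarrow> finite (edges G)"
  unfolding fin_graph_def using finite_pairs finite_subset by blast

lemma verts_induced [simp]: "verts (induced G S) = S"
  by (simp add: induced_def)

lemma fin_graph_induced: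
  assumes "fin_graph G" "S \<subseteq> verts G"
  shows "fin_graph (induced G S)"
  using assms finite_subset unfolding fin_graph_def induced_def pairs_def by fastforce

lemma subgraph_induced:
  assumes "fin_graph G" "S \<subseteq> verts G"
  shows "subgraph (induced G S) G"
  using fin_graph_induced[OF assms] assms by (auto simp: subgraph_def induced_def)

lemma induced_clique:
  assumes "fin_graph G" "is_clique G S"
  shows "induced G S = (S, pairs S)"
  using assms unfolding induced_def is_clique_def fin_graph_def pairs_def by auto

text \<open>Double counting of vertex-edge incidences: well-formedness of the graph places both ends
  of every edge among the vertices.\<close>

lemma sum_vdegree:
  assumes "fin_graph G"
  shows "(\<Sum>v\<in>verts G. vdegree G v) = 2 * card (edges G)"
proof -
  have fin: "finite (verts G)" "finite (edges G)"
    using assms fin_graph_finite_edges[OF assms] by (auto simp: fin_graph_def)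
  have "card {v \<in> verts G. v \<in> e} = 2" if "e \<in> edges G" for e
  proof -
    have "{v \<in> verts G. v \<in> e} = e"
      using assms that by (auto simp: fin_graph_def pairs_def)
    then show ?thesis
      using assms that by (auto simp: fin_graph_def pairs_def)
  qed
  then show ?thesis
    unfolding vdegree_def using sum_multicount[OF fin, of "\<lambda>v e. v \<in> e" 2] by simp
qed

text \<open>\<open>vdegree\<close> counts incident edges, while separating sets and blocked colours
  are sets of neighbours. The injection \<open>u\<close> to \<open>{u, v}\<close> passes from one
  count to the other.\<close>

lemma vdegree_ge_card_neighbours:
  assumes "finite (edges G)"
  shows "finite {u. u \<noteq> v \<and> {u, v} \<in> edges G}"
    and "card {u. u \<noteq> v \<and> {u, v} \<in> edges G} \<le> vdegree G v"
proof -
  let ?N = "{u. u \<noteq> v \<and> {u, v} \<in> edges G}"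
  have inj: "inj_on (\<lambda>u. {u, v}) ?N"
    by (rule inj_onI) (auto simp: doubleton_eq_iff)
  have sub: "(\<lambda>u. {u, v}) ` ?N \<subseteq> {e \<in> edges G. v \<in> e}" by auto
  show "finite ?N"
    using inj_on_finite[OF inj sub] assms by simp
  show "card ?N \<le> vdegree G v"
    unfolding vdegree_def using card_inj_on_le[OF inj sub] assms by simp
qed

lemma obtain_min_degree_vertex:
  assumes "finite (verts G)" "verts G \<noteq> {}"
  obtains v where "v \<in> verts G" "vdegree G v = min_degree G"
proof -
  have "min_degree G \<in> vdegree G ` verts G"
    unfolding min_degree_def using assms by (intro Min_in) auto
  then show thesis using that by auto
qed

section \<open>Parameters maximised over induced subgraphs\<close>

lemma max_induced_ge:
  assumes "fin_graph G" "S \<subseteq> verts G" "S \<noteq> {}"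
  shows "f (induced G S) \<le> max_induced f G"
proof -
  have "finite ((\<lambda>S. f (induced G S)) ` Pow (verts G))"
    using assms by (simp add: fin_graph_def)
  then have "finite {f (induced G S) | S. S \<subseteq> verts G \<and> S \<noteq> {}}"
    by (rule rev_finite_subset) auto
  then show ?thesis
    unfolding max_induced_def using assms by (intro Max_ge) auto
qed

lemma max_induced_attained:
  assumes "fin_graph G" "verts G \<noteq> {}"
  obtains S where "S \<subseteq> verts G" "S \<noteq> {}" "max_induced f G = f (induced G S)"
proof -
  let ?A = "{f (induced G S) | S. S \<subseteq> verts G \<and> S \<noteq> {}}"
  have "finite ((\<lambda>S. f (induced G S)) ` Pow (verts G))"
    using assms by (simp add: fin_graph_def)
  then have "finite ?A" by (rule rev_finite_subset) auto
  moreover have "?A \<noteq> {}" using assms(2) by auto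
  ultimately have "max_induced f G \<in> ?A"
    unfolding max_induced_def by (rule Max_in)
  then show thesis using that by auto
qed

lemma max_induced_mono:
  assumes "fin_graph G" "verts G \<noteq> {}"
    and "\<And>H. fin_graph H \<Longrightarrow> verts H \<noteq> {} \<Longrightarrow> f H \<le> g H"
  shows "max_induced f G \<le> max_induced g G"
proof -
  obtain S where S: "S \<subseteq> verts G" "S \<noteq> {}" "max_induced f G = f (induced G S)"
    using max_induced_attained[OF assms(1,2)] .
  have "f (induced G S) \<le> g (induced G S)"
    using assms(3) fin_graph_induced[OF assms(1) S(1)] S(2) by simp
  also have "\<dots> \<le> max_induced g G"
    using max_induced_ge[OF assms(1) S(1,2)] .
  finally show ?thesis using S(3) by simp
qed

section \<open>Maximum average degree\<close>

lemma finite_Mad_set: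
  assumes "fin_graph G"
  shows "finite {2 * real (card (edges H)) / real (card (verts H)) | H.
                  subgraph H G \<and> card (verts H) \<ge> 1}"
proof -
  have "finite (Pow (verts G) \<times> Pow (edges G))"
    using assms fin_graph_finite_edges[OF assms] by (auto simp: fin_graph_def)
  then have "finite ((\<lambda>H. 2 * real (card (edges H)) / real (card (verts H))) `
      (Pow (verts G) \<times> Pow (edges G)))"
    by (rule finite_imageI)
  then show ?thesis
    by (rule rev_finite_subset) (fastforce simp: subgraph_def)
qed

lemma Mad_ge:
  assumes "fin_graph G" "subgraph H G" "card (verts H) \<ge> 1"
  shows "2 * real (card (edges H)) / real (card (verts H)) \<le> Mad G"
  unfolding Mad_def using finite_Mad_set[OF assms(1)] assms(2,3) by (intro Max_ge) blast+

lemma Mad_attained: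
  assumes "fin_graph G" "verts G \<noteq> {}"
  obtains H where "subgraph H G" "card (verts H) \<ge> 1"
    "Mad G = 2 * real (card (edges H)) / real (card (verts H))"
proof -
  have "subgraph G G \<and> card (verts G) \<ge> 1"
    using assms by (auto simp: subgraph_def fin_graph_def Suc_le_eq card_gt_0_iff)
  then have "{2 * real (card (edges H)) / real (card (verts H)) | H.
                  subgraph H G \<and> card (verts H) \<ge> 1} \<noteq> {}" by blast
  from Max_in[OF finite_Mad_set[OF assms(1)] this]
  show thesis using that unfolding Mad_def by auto
qed

lemma real_choose_two: "real (m choose 2) = real m * (real m - 1) / 2"
  by (cases m) (auto simp: choose_two real_of_nat_div algebra_simps)

lemma subgraph_card_edges_le:
  assumes "fin_graph G" "subgraph H G"
  shows "card (edges H) \<le> card (edges G)" "card (edges H) \<le> card (verts H) choose 2"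
proof -
  show "card (edges H) \<le> card (edges G)"
    using assms fin_graph_finite_edges[OF assms(1)] by (auto simp: subgraph_def intro: card_mono)
  have "finite (verts H)" "edges H \<subseteq> pairs (verts H)"
    using assms(2) by (auto simp: subgraph_def fin_graph_def)
  then show "card (edges H) \<le> card (verts H) choose 2"
    using card_mono[OF finite_pairs] card_pairs by metis
qed

text \<open>A subgraph on \<open>v\<close> vertices has at most \<open>v choose 2\<close> and at
  most \<open>m choose 2\<close> edges. The first bound gives average degree at most
  \<open>m - 1\<close> when \<open>v\<close> is at most \<open>m\<close>, the second when
  \<open>v\<close> exceeds \<open>m\<close>.\<close>

lemma Mad_le_of_card_edges:
  assumes "fin_graph G" "verts G \<noteq> {}" "card (edges G) \<le> m choose 2" "m \<ge> 1"
  shows "Mad G \<le> real m - 1"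
proof -
  obtain H where H: "subgraph H G" "card (verts H) \<ge> 1"
    "Mad G = 2 * real (card (edges H)) / real (card (verts H))"
    using Mad_attained[OF assms(1,2)] .
  let ?v = "real (card (verts H))" and ?e = "real (card (edges H))"
  note le = subgraph_card_edges_le[OF assms(1) H(1)]
  have "?e \<le> real (m choose 2)" "?e \<le> real (card (verts H) choose 2)"
    using le assms(3) by linarith+
  then have e: "2 * ?e \<le> real m * (real m - 1)" "2 * ?e \<le> ?v * (?v - 1)"
    by (simp_all add: real_choose_two)
  have "2 * ?e \<le> (real m - 1) * ?v"
  proof (cases "?v \<le> real m")
    case True
    then have "?v * (?v - 1) \<le> ?v * (real m - 1)" by (intro mult_left_mono) auto
    then show ?thesis using e(2) by (simp add: mult.commute)
  next
    case False
    then have "real m * (real m - 1) \<le> ?v * (real m - 1)"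
      using assms(4) by (intro mult_right_mono) auto
    then show ?thesis using e(1) by (simp add: mult.commute)
  qed
  then show ?thesis using H(2,3) by (simp add: divide_le_eq)
qed

text \<open>The strict variant, with the split at \<open>p\<close> vertices: up to \<open>p\<close>
  vertices the average degree is at most \<open>p - 1\<close>, and from \<open>p + 1\<close>
  vertices on the strict edge bound takes over.\<close>

lemma Mad_less_of_card_edges:
  assumes "fin_graph G" "verts G \<noteq> {}" "card (edges G) < (p + 1) choose 2"
  shows "Mad G < real p"
proof -
  obtain H where H: "subgraph H G" "card (verts H) \<ge> 1"
    "Mad G = 2 * real (card (edges H)) / real (card (verts H))"
    using Mad_attained[OF assms(1,2)] .
  let ?v = "real (card (verts H))" and ?e = "real (card (edges H))"
  note le = subgraph_card_edges_le[OF assms(1) H(1)]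
  have "?e < real ((p + 1) choose 2)" "?e \<le> real (card (verts H) choose 2)"
    using le assms(3) by linarith+
  then have e: "2 * ?e < (real p + 1) * real p" "2 * ?e \<le> ?v * (?v - 1)"
    by (simp_all add: real_choose_two add.commute)
  have "2 * ?e < real p * ?v"
  proof (cases "card (verts H) \<le> p")
    case True
    then have "?v * (?v - 1) < ?v * real p"
      using H(2) by (intro mult_strict_left_mono) auto
    then show ?thesis using e(2) by (simp add: mult.commute)
  next
    case False
    then have "(real p + 1) * real p \<le> ?v * real p"
      by (intro mult_right_mono) auto
    then show ?thesis using e(1) by (simp add: mult.commute)
  qed
  then show ?thesis using H(2,3) by (simp add: divide_less_eq)
qed

text \<open>An induced subgraph attaining the degeneracy has minimum degree at most its average
  degree, and that average is among the values maximised by \<open>Mad\<close>.\<close>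

lemma degeneracy_le_Mad:
  assumes "fin_graph G" "verts G \<noteq> {}"
  shows "real (degeneracy G) \<le> Mad G"
proof -
  obtain S where S: "S \<subseteq> verts G" "S \<noteq> {}" "degeneracy G = min_degree (induced G S)"
    unfolding degeneracy_def using max_induced_attained[OF assms] .
  let ?H = "induced G S"
  have H: "fin_graph ?H" using fin_graph_induced[OF assms(1) S(1)] .
  have "finite S" using H by (simp add: fin_graph_def)
  have "card S * min_degree ?H \<le> (\<Sum>v\<in>S. vdegree ?H v)"
    using sum_bounded_below[of S "min_degree ?H" "vdegree ?H"] \<open>finite S\<close>
    by (simp add: min_degree_def)
  also have "\<dots> = 2 * card (edges ?H)" using sum_vdegree[OF H] by simp
  finally have "real (card S) * real (min_degree ?H) \<le> 2 * real (card (edges ?H))"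
    by (metis of_nat_le_iff of_nat_mult of_nat_numeral)
  moreover have S1: "card S \<ge> 1"
    using \<open>finite S\<close> S(2) by (simp add: Suc_le_eq card_gt_0_iff)
  ultimately have "real (min_degree ?H) \<le> 2 * real (card (edges ?H)) / real (card S)"
    by (simp add: le_divide_eq mult.commute)
  also have "\<dots> \<le> Mad G"
    using Mad_ge[OF assms(1) subgraph_induced[OF assms(1) S(1)]] S1 by simp
  finally show ?thesis using S(3) by simp
qed

section \<open>Connectivity\<close>

lemma not_connected_if_isolated:
  assumes "v \<in> verts G" "w \<in> verts G" "v \<noteq> w" "\<And>u. {v, u} \<notin> edges G"
  shows "\<not> connected_graph G"
proof
  assume "connected_graph G"
  then have "(\<lambda>x y. {x, y} \<in> edges G)\<^sup>*\<^sup>* v w"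
    using assms unfolding connected_graph_def by blast
  then show False
    using assms(3,4) by (cases rule: converse_rtranclpE) auto
qed

text \<open>Deleting the neighbours of a vertex \<open>v\<close> of minimum degree either isolates
  \<open>v\<close> from some remaining vertex or leaves \<open>v\<close> alone. Each outcome matches
  one clause of the definition.\<close>

lemma vertex_connectivity_le_min_degree:
  assumes "fin_graph G" "verts G \<noteq> {}"
  shows "vertex_connectivity G \<le> min_degree G"
proof -
  have fin: "finite (verts G)" using assms by (simp add: fin_graph_def)
  obtain v where v: "v \<in> verts G" "vdegree G v = min_degree G"
    using obtain_min_degree_vertex[OF fin assms(2)] .
  define X where "X = {u. u \<noteq> v \<and> {u, v} \<in> edges G}"
  have X: "X \<subset> verts G"
    using assms(1) v(1) unfolding X_def fin_graph_def pairs_def by auto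
  have sep: "\<not> connected_graph (induced G (verts G - X)) \<or> card (verts G - X) = 1"
  proof (cases "verts G - X = {v}")
    case False
    have "v \<notin> X" by (simp add: X_def)
    then obtain w where w: "w \<in> verts G - X" "w \<noteq> v" using False v(1) by auto
    have "{v, u} \<notin> edges (induced G (verts G - X))" for u
    proof
      assume "{v, u} \<in> edges (induced G (verts G - X))"
      then have e: "{v, u} \<in> edges G" "u \<notin> X" by (auto simp: induced_def)
      then have "u = v" by (auto simp: X_def insert_commute)
      then show False using e(1) assms(1) by (auto simp: fin_graph_def pairs_def)
    qed
    then have "\<not> connected_graph (induced G (verts G - X))"
      using v(1) w \<open>v \<notin> X\<close> by (intro not_connected_if_isolated[of v _ w]) auto
    then show ?thesis ..
  qed simp
  have "finite (card ` Pow (verts G))" using fin by simp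
  then have "finite {card X | X. X \<subset> verts G \<and>
      (\<not> connected_graph (induced G (verts G - X)) \<or> card (verts G - X) = 1)}"
    by (rule rev_finite_subset) auto
  then have "vertex_connectivity G \<le> card X"
    unfolding vertex_connectivity_def using X sep by (intro Min_le) auto
  also have "\<dots> \<le> vdegree G v"
    unfolding X_def using vdegree_ge_card_neighbours(2) fin_graph_finite_edges[OF assms(1)] .
  finally show ?thesis using v(2) by simp
qed

text \<open>Deleting all edges at a vertex of minimum degree isolates it from any other vertex; with
  at most one vertex the connectivity is 0 by convention.\<close>

lemma edge_connectivity_le_min_degree:
  assumes "fin_graph G" "verts G \<noteq> {}"
  shows "edge_connectivity G \<le> min_degree G"
proof (cases "card (verts G) \<le> 1")
  case False
  have fin: "finite (verts G)" using assms by (simp add: fin_graph_def)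
  obtain v where v: "v \<in> verts G" "vdegree G v = min_degree G"
    using obtain_min_degree_vertex[OF fin assms(2)] .
  define F where "F = {e \<in> edges G. v \<in> e}"
  have "verts G \<noteq> {v}" using False by auto
  then obtain w where w: "w \<in> verts G" "w \<noteq> v" using v(1) by auto
  have "\<not> connected_graph (verts G, edges G - F)"
    using v(1) w by (intro not_connected_if_isolated[of v _ w]) (auto simp: F_def)
  moreover have "F \<subseteq> edges G" by (auto simp: F_def)
  moreover have "finite (card ` Pow (edges G))"
    using fin_graph_finite_edges[OF assms(1)] by simp
  then have "finite {card F | F. F \<subseteq> edges G \<and> \<not> connected_graph (verts G, edges G - F)}"
    by (rule rev_finite_subset) auto
  ultimately have "edge_connectivity G \<le> card F"
    unfolding edge_connectivity_def using False by (auto intro!: Min_le)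
  then show ?thesis using v(2) by (simp add: F_def vdegree_def)
qed (simp add: edge_connectivity_def)

section \<open>Connectivity of complete graphs\<close>

lemma connected_complete: "connected_graph (S, pairs S)"
  unfolding connected_graph_def
proof (intro ballI)
  fix u v assume "u \<in> verts (S, pairs S)" "v \<in> verts (S, pairs S)"
  then show "(\<lambda>x y. {x, y} \<in> edges (S, pairs S))\<^sup>*\<^sup>* u v"
    by (cases "u = v") (auto simp: doubleton_in_pairs intro!: r_into_rtranclp)
qed

text \<open>Whatever remains after deleting vertices is again complete, hence connected. So only the
  single-vertex clause can hold, and it forces the deletion of all vertices but one.\<close>

lemma vertex_connectivity_complete:
  assumes "finite S" "S \<noteq> {}"
  shows "card S - 1 \<le> vertex_connectivity (S, pairs S)"
proof -
  let ?A = "{card X | X. X \<subset> S \<and>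
      (\<not> connected_graph (induced (S, pairs S) (S - X)) \<or> card (S - X) = 1)}"
  have "finite (card ` Pow S)" using assms by simp
  then have fin: "finite ?A" by (rule rev_finite_subset) auto
  \<comment> \<open>A \<open>Min\<close> can be bounded below only over a nonempty set, so a
    separating set is exhibited: all vertices except \<open>s\<close>.\<close>
  obtain s where s: "s \<in> S" using assms(2) by auto
  then have "S - (S - {s}) = {s}" by auto
  then have "card (S - {s}) \<in> ?A" using s by (intro CollectI exI[of _ "S - {s}"]) auto
  then have ne: "?A \<noteq> {}" by blast
  have "card S - 1 \<le> a" if a: "a \<in> ?A" for a
  proof -
    obtain X where X: "a = card X" "X \<subset> S"
      "\<not> connected_graph (induced (S, pairs S) (S - X)) \<or> card (S - X) = 1"
      using a by blast
    have "induced (S, pairs S) (S - X) = (S - X, pairs (S - X))"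
      by (auto simp: induced_def pairs_def)
    then have "card (S - X) = 1" using X(3) connected_complete by metis
    moreover have "card (S - X) = card S - card X"
      using X(2) assms(1) by (meson card_Diff_subset finite_subset psubset_imp_subset)
    ultimately show ?thesis using X(1) by linarith
  qed
  then show ?thesis
    unfolding vertex_connectivity_def using fin ne by simp
qed

lemma disconnecting_complete:
  assumes "finite S" "F \<subseteq> pairs S" "\<not> connected_graph (S, pairs S - F)"
  shows "card S - 1 \<le> card F"
proof -
  let ?R = "\<lambda>x y. {x, y} \<in> pairs S - F"
  obtain u v where uv: "u \<in> S" "v \<in> S" "\<not> ?R\<^sup>*\<^sup>* u v"
    using assms(3) by (auto simp: connected_graph_def)
  then have ne: "u \<noteq> v" by auto
  \<comment> \<open>The paths of length at most 2 from \<open>u\<close> to \<open>v\<close> are edge-disjoint, and \<open>F\<close> meets each of them.\<close>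
  define f where "f w = (if {u, w} \<in> F then {u, w} else {w, v})" for w
  have uvF: "{u, v} \<in> F"
    using uv ne by (auto simp: doubleton_in_pairs intro: r_into_rtranclp)
  have "f w \<in> F" if w: "w \<in> S - {u}" for w
  proof (rule ccontr)
    assume nF: "f w \<notin> F"
    then have "w \<noteq> v" using uvF by (auto simp: f_def)
    \<comment> \<open>\<open>f w\<close> outside \<open>F\<close> excludes the first branch of
      \<open>f\<close>, so both \<open>{u, w}\<close> and \<open>{w, v}\<close> survive the
      deletion.\<close>
    then have "?R u w" "?R w v"
      using nF w uv by (auto simp: f_def doubleton_in_pairs split: if_splits)
    then have "?R\<^sup>*\<^sup>* u v" by (meson converse_rtranclp_into_rtranclp r_into_rtranclp)
    then show False using uv(3) by simp
  qed
  then have sub: "f ` (S - {u}) \<subseteq> F" by auto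
  \<comment> \<open>By \<open>uvF\<close> the index \<open>v\<close> takes the first branch and
    stands for the direct edge. A clash \<open>{u, w} = {w', v}\<close> of the two branches would
    need \<open>w' = u\<close>, which the domain excludes, or \<open>w = w'\<close>.\<close>
  have "inj_on f (S - {u})"
    by (rule inj_onI) (use uvF in \<open>auto simp: f_def doubleton_eq_iff split: if_splits\<close>)
  then have "card (S - {u}) \<le> card F"
    using sub finite_subset[OF assms(2) finite_pairs[OF assms(1)]] by (rule card_inj_on_le)
  then show ?thesis using uv(1) by simp
qed

lemma edge_connectivity_complete:
  assumes "finite S"
  shows "card S - 1 \<le> edge_connectivity (S, pairs S)"
proof (cases "card S \<le> 1")
  case False
  let ?A = "{card F | F. F \<subseteq> pairs S \<and> \<not> connected_graph (S, pairs S - F)}"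
  have "finite (card ` Pow (pairs S))" using finite_pairs[OF assms] by simp
  then have fin: "finite ?A" by (rule rev_finite_subset) auto
  obtain u where u: "u \<in> S" using False by fastforce
  have "S \<noteq> {u}" using False by auto
  then obtain w where w: "w \<in> S" "w \<noteq> u" using u by auto
  \<comment> \<open>Deleting every edge separates \<open>u\<close> from \<open>w\<close>, so the set
    under \<open>Min\<close> is nonempty.\<close>
  have "\<not> connected_graph (S, pairs S - pairs S)"
    using u w by (intro not_connected_if_isolated[of u _ w]) auto
  then have "?A \<noteq> {}" by blast
  then have "card S - 1 \<le> Min ?A"
    using fin disconnecting_complete[OF assms] by auto
  then show ?thesis using False by (simp add: edge_connectivity_def)
qed simp

section \<open>Cliques as lower bounds for the starred connectivities\<close>

lemma clique_number_ge:
  assumes "fin_graph G" "is_clique G S"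
  shows "card S \<le> clique_number G"
proof -
  have "finite (card ` Pow (verts G))" using assms by (simp add: fin_graph_def)
  then have "finite {card S | S. is_clique G S}"
    by (rule rev_finite_subset) (auto simp: is_clique_def)
  then show ?thesis unfolding clique_number_def using assms(2) by (intro Max_ge) auto
qed

lemma clique_number_attained:
  assumes "fin_graph G"
  obtains S where "is_clique G S" "card S = clique_number G"
proof -
  have "finite (card ` Pow (verts G))" using assms by (simp add: fin_graph_def)
  then have "finite {card S | S. is_clique G S}"
    by (rule rev_finite_subset) (auto simp: is_clique_def)
  moreover have "is_clique G {}" by (auto simp: is_clique_def pairs_def)
  then have "{card S | S. is_clique G S} \<noteq> {}" by blast
  ultimately have "clique_number G \<in> {card S | S. is_clique G S}"
    unfolding clique_number_def by (rule Max_in)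
  then show thesis using that by auto
qed

text \<open>A single vertex spans no pairs and so is a clique. Consequently a maximum clique is
  nonempty and is admissible in \<open>max_induced\<close>.\<close>

lemma clique_number_pos:
  assumes "fin_graph G" "verts G \<noteq> {}"
  shows "1 \<le> clique_number G"
proof -
  obtain v where v: "v \<in> verts G" using assms(2) by auto
  have "e \<notin> pairs {v}" for e
    using card_mono[of "{v}" e] by (auto simp: pairs_def)
  then have "is_clique G {v}" using v by (auto simp: is_clique_def)
  then show ?thesis using clique_number_ge[OF assms(1)] by fastforce
qed

text \<open>A maximum clique induces a complete graph, so the value of \<open>f\<close> on complete
  graphs bounds the maximum from below. This treats both connectivities at once.\<close>

lemma clique_number_le_max_induced:
  assumes "fin_graph G" "verts G \<noteq> {}"
    and "\<And>S. finite S \<Longrightarrow> S \<noteq> {} \<Longrightarrow> card S - 1 \<le> f (S, pairs S)"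
  shows "clique_number G \<le> max_induced f G + 1"
proof -
  obtain S where S: "is_clique G S" "card S = clique_number G"
    using clique_number_attained[OF assms(1)] .
  have "S \<noteq> {}" using S(2) clique_number_pos[OF assms(1,2)] by auto
  moreover have sub: "S \<subseteq> verts G" using S(1) by (simp add: is_clique_def)
  moreover have "finite S"
    using sub assms(1) finite_subset by (auto simp: fin_graph_def)
  ultimately have "card S - 1 \<le> max_induced f G"
    using assms(3)[of S] max_induced_ge[OF assms(1), of S f] induced_clique[OF assms(1) S(1)]
    by simp
  then show ?thesis using S(2) by simp
qed

lemma clique_number_le_kappa_star:
  assumes "fin_graph G" "verts G \<noteq> {}"
  shows "clique_number G \<le> kappa_star G + 1"
  unfolding kappa_star_def
  using clique_number_le_max_induced[OF assms] vertex_connectivity_complete by blast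

lemma clique_number_le_lambda_star:
  assumes "fin_graph G" "verts G \<noteq> {}"
  shows "clique_number G \<le> lambda_star G + 1"
  unfolding lambda_star_def
  using clique_number_le_max_induced[OF assms] edge_connectivity_complete by blast

lemma kappa_star_le_degeneracy:
  assumes "fin_graph G" "verts G \<noteq> {}"
  shows "kappa_star G \<le> degeneracy G"
  unfolding kappa_star_def degeneracy_def
  using max_induced_mono[OF assms] vertex_connectivity_le_min_degree by blast

lemma lambda_star_le_degeneracy:
  assumes "fin_graph G" "verts G \<noteq> {}"
  shows "lambda_star G \<le> degeneracy G"
  unfolding lambda_star_def degeneracy_def
  using max_induced_mono[OF assms] edge_connectivity_le_min_degree by blast

section \<open>Colouring parameters\<close>

text \<open>Greedy colouring: remove a vertex of minimum degree, colour the rest by induction, and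
  put it back. Its neighbours block at most \<open>degeneracy G\<close> colours, one fewer than its
  list holds. The list size refers to the whole of \<open>G\<close>, so it stays fixed while
  \<open>S\<close> shrinks.\<close>

lemma list_colouring_of_induced:
  assumes "fin_graph G" "S \<subseteq> verts G"
    and L: "\<And>v. v \<in> verts G \<Longrightarrow> finite (L v) \<and> card (L v) = degeneracy G + 1"
  shows "\<exists>f :: 'a \<Rightarrow> nat. proper_coloring (induced G S) f \<and> (\<forall>v \<in> S. f v \<in> L v)"
proof -
  have "finite S" using assms finite_subset by (auto simp: fin_graph_def)
  then show ?thesis using assms(2)
  proof (induction "card S" arbitrary: S)
    case 0
    then show ?case by (auto simp: proper_coloring_def)
  next
    case (Suc m)
    let ?H = "induced G S"
    have "S \<noteq> {}" using Suc.hyps(2) by auto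
    then obtain v where v: "v \<in> S" "vdegree ?H v = min_degree ?H"
      using obtain_min_degree_vertex[of ?H] Suc.prems by auto
    have "m = card (S - {v})" using Suc.hyps(2) v(1) Suc.prems by simp
    then obtain f where f: "proper_coloring (induced G (S - {v})) f" "\<forall>u \<in> S - {v}. f u \<in> L u"
      using Suc.hyps(1)[of "S - {v}"] Suc.prems by auto
    let ?N = "{u. u \<noteq> v \<and> {u, v} \<in> edges ?H}"
    have "finite (edges ?H)"
      using fin_graph_finite_edges fin_graph_induced[OF assms(1) Suc.prems(2)] by blast
    note N = vdegree_ge_card_neighbours[OF this, of v]
    have "card (f ` ?N) \<le> vdegree ?H v" using card_image_le[OF N(1), of f] N(2) by linarith
    also have "\<dots> \<le> degeneracy G"
      unfolding v(2) degeneracy_def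
      using max_induced_ge[OF assms(1) Suc.prems(2) \<open>S \<noteq> {}\<close>] .
    also have "\<dots> < card (L v)" using L v(1) Suc.prems(2) by auto
    finally have "\<not> L v \<subseteq> f ` ?N"
      using card_mono[OF finite_imageI[OF N(1)], of "L v" f] by linarith
    then obtain c where c: "c \<in> L v" "c \<notin> f ` ?N" by auto
    have "proper_coloring ?H (f(v := c))"
      unfolding proper_coloring_def
    proof (intro ballI impI, elim conjE)
      fix x y assume xy: "x \<in> verts ?H" "y \<in> verts ?H" "x \<noteq> y" "{x, y} \<in> edges ?H"
      consider "x = v" | "y = v" | "x \<noteq> v" "y \<noteq> v" by auto
      then show "(f(v := c)) x \<noteq> (f(v := c)) y"
      proof cases
        case 1
        then have "y \<in> ?N" using xy by (auto simp: insert_commute)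
        then show ?thesis using c(2) 1 by auto
      next
        case 2
        then have "x \<in> ?N" using xy by auto
        then show ?thesis using c(2) 2 by auto
      next
        case 3
        then have "{x, y} \<in> edges (induced G (S - {v}))"
          using xy by (auto simp: induced_def)
        then show ?thesis using f(1) 3 xy by (auto simp: proper_coloring_def)
      qed
    qed
    moreover have "\<forall>u \<in> S. (f(v := c)) u \<in> L u" using f(2) c(1) by auto
    ultimately show ?case by blast
  qed
qed

text \<open>Besides bounding the choice number, this provides the witness that the
  \<open>LEAST\<close> in \<open>choice_number\<close> and in \<open>chromatic_number\<close> is
  attained.\<close>

lemma choosable_coloring_number:
  assumes "fin_graph G"
  shows "choosable G (coloring_number G)"
proof -
  have "induced G (verts G) = G"
    using assms by (cases G) (auto simp: induced_def fin_graph_def pairs_def)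
  with list_colouring_of_induced[OF assms subset_refl] show ?thesis
    unfolding choosable_def coloring_number_def by auto
qed

lemma choice_number_le_coloring_number:
  "fin_graph G \<Longrightarrow> choice_number G \<le> coloring_number G"
  unfolding choice_number_def by (intro Least_le choosable_coloring_number)

text \<open>Ordinary colouring is list colouring with the constant list
  \<open>{..<c}\<close>.\<close>

lemma choosable_imp_colorable:
  assumes "choosable G c"
  shows "\<exists>f. proper_coloring G f \<and> (\<forall>v \<in> verts G. f v < c)"
  using assms[unfolded choosable_def, rule_format, of "\<lambda>_. {..<c}"] by auto

lemma chromatic_number_le_choice_number:
  assumes "fin_graph G"
  shows "chromatic_number G \<le> choice_number G"
proof -
  have "choosable G (choice_number G)"
    unfolding choice_number_def using choosable_coloring_number[OF assms] by (rule LeastI)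
  then show ?thesis
    unfolding chromatic_number_def by (intro Least_le choosable_imp_colorable)
qed

text \<open>A proper colouring is injective on a clique.\<close>

lemma clique_number_le_chromatic_number:
  assumes "fin_graph G"
  shows "clique_number G \<le> chromatic_number G"
proof -
  have "\<exists>f. proper_coloring G f \<and> (\<forall>v \<in> verts G. f v < chromatic_number G)"
    unfolding chromatic_number_def
    using choosable_imp_colorable[OF choosable_coloring_number[OF assms]] by (rule LeastI)
  then obtain f where f: "proper_coloring G f" "\<forall>v \<in> verts G. f v < chromatic_number G"
    by blast
  obtain S where S: "is_clique G S" "card S = clique_number G"
    using clique_number_attained[OF assms] .
  have "inj_on f S"
  proof (rule inj_onI, rule ccontr)
    fix x y assume xy: "x \<in> S" "y \<in> S" "f x = f y" "x \<noteq> y"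
    then have "{x, y} \<in> edges G" "x \<in> verts G" "y \<in> verts G"
      using S(1) by (auto simp: is_clique_def doubleton_in_pairs subset_iff)
    then show False using f(1) xy by (auto simp: proper_coloring_def)
  qed
  moreover have "f ` S \<subseteq> {..<chromatic_number G}"
    using f(2) S(1) by (auto simp: is_clique_def)
  ultimately have "card S \<le> chromatic_number G"
    using card_inj_on_le[of f S "{..<chromatic_number G}"] by simp
  then show ?thesis using S(2) by simp
qed

section \<open>Edge partitions and packings\<close>

lemma edge_partition_member:
  assumes "edge_partition k n G" "i < k"
  shows "verts (G i) = {..<n}" "fin_graph (G i)"
  using assms by (auto simp: edge_partition_def fin_graph_def complete_graph_def)

text \<open>The functions \<open>G\<close> are unconstrained from index \<open>k\<close> on, so the
  partitions themselves form an infinite set. The sum depends only on the restriction to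
  \<open>{..<k}\<close>, which ranges over a finite function space.\<close>

lemma finite_param_sums: "finite {(\<Sum>i<k. f (G i)) | G. edge_partition k n G}"
proof -
  let ?P = "{..<k} \<rightarrow>\<^sub>E {{..<n}} \<times> Pow (pairs {..<n})"
  have "finite ?P" by (intro finite_PiE) (auto simp: finite_pairs)
  then have "finite ((\<lambda>G. \<Sum>i<k. f (G i)) ` ?P)" by (rule finite_imageI)
  moreover have "(\<Sum>i<k. f (G i)) \<in> (\<lambda>G. \<Sum>i<k. f (G i)) ` ?P" if "edge_partition k n G" for G
  proof
    show "(\<Sum>i<k. f (G i)) = (\<Sum>i<k. f (restrict G {..<k} i))" by simp
    show "restrict G {..<k} \<in> ?P"
      using edge_partition_member[OF that]
      by (auto simp: PiE_iff mem_Times_iff fin_graph_def)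
  qed
  ultimately show ?thesis by (auto elim!: rev_finite_subset)
qed

lemma param_max_ge:
  "edge_partition k n G \<Longrightarrow> (\<Sum>i<k. f (G i)) \<le> param_max f k n"
  unfolding param_max_def by (intro Max_ge finite_param_sums) auto

lemma param_max_eqI:
  assumes "edge_partition k n G" "b \<le> (\<Sum>i<k. f (G i))"
    and "\<And>H. edge_partition k n H \<Longrightarrow> (\<Sum>i<k. f (H i)) \<le> b"
  shows "param_max f k n = b"
proof -
  have "(\<Sum>i<k. f (G i)) = b" using assms by (meson order.antisym)
  then show ?thesis
    unfolding param_max_def using assms by (intro Max_eqI finite_param_sums) auto
qed

text \<open>Packings are described up to isolated vertices, while the parameters are evaluated on
  spanning subgraphs; cliques carry over from the former to the latter.\<close>

lemma is_clique_of_drop_isolated: "is_clique (drop_isolated G) S \<Longrightarrow> is_clique G S"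
  by (auto simp: is_clique_def drop_isolated_def)

lemma fin_graph_drop_isolated: "fin_graph G \<Longrightarrow> fin_graph (drop_isolated G)"
  by (auto simp: fin_graph_def drop_isolated_def pairs_def)

text \<open>The edge count \<open>m choose 2\<close> bounds \<open>Mad\<close> by
  \<open>m - 1\<close> despite the isolated vertices, and the vertices of the copy form a clique of
  size \<open>m\<close>.\<close>

lemma Mad_le_clique_number_of_copy:
  assumes "fin_graph G" "verts G \<noteq> {}" "copy_of_complete m (drop_isolated G)" "m \<ge> 1"
  shows "Mad G \<le> real (clique_number G) - 1"
proof -
  let ?D = "drop_isolated G"
  have D: "finite (verts ?D)" "card (verts ?D) = m" "edges ?D = pairs (verts ?D)"
    using assms(3) by (auto simp: copy_of_complete_def)
  have "edges ?D = edges G" by (simp add: drop_isolated_def)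
  then have "card (edges G) = m choose 2" using D card_pairs by metis
  then have "Mad G \<le> real m - 1" using Mad_le_of_card_edges[OF assms(1,2) _ assms(4)] by simp
  moreover have "is_clique G (verts ?D)"
    by (rule is_clique_of_drop_isolated) (simp add: is_clique_def D(3))
  then have "m \<le> clique_number G" using clique_number_ge[OF assms(1)] D(2) by blast
  ultimately show ?thesis by linarith
qed

text \<open>A clique of size \<open>p\<close> comes from the family itself below the threshold
  \<open>(p - 1) / 2\<close> and from the last assumption otherwise. The edge count keeps
  \<open>Mad\<close> strictly below \<open>p\<close>.\<close>

lemma Mad_less_clique_number_of_F_family:
  assumes "fin_graph G" "verts G \<noteq> {}" "drop_isolated G \<in> F_family p r" "r < p"
    and "real r \<ge> (real p - 1) / 2 \<Longrightarrow> clique_number (drop_isolated G) = p"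
  shows "Mad G < real (clique_number G)"
proof -
  let ?D = "drop_isolated G"
  have "\<exists>S. is_clique ?D S \<and> card S = p"
  proof (cases "real r < (real p - 1) / 2")
    case True
    then have "contains_complete p ?D" using assms(3) by (simp add: F_family_def)
    then obtain H where H: "subgraph H ?D" "copy_of_complete p H"
      by (auto simp: contains_complete_def)
    then have "is_clique ?D (verts H)" "card (verts H) = p"
      by (simp_all add: subgraph_def copy_of_complete_def is_clique_def)
    then show ?thesis by blast
  next
    case False
    then have "clique_number ?D = p" using assms(5) by simp
    then show ?thesis
      using clique_number_attained[OF fin_graph_drop_isolated[OF assms(1)]] by metis
  qed
  then have "p \<le> clique_number G"
    using clique_number_ge[OF assms(1)] is_clique_of_drop_isolated by blast
  moreover have "card (edges G) = (p choose 2) + r"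
    using assms(3) by (simp add: F_family_def drop_isolated_def)
  \<comment> \<open>By Pascal's rule \<open>(p + 1) choose 2\<close> is
    \<open>(p choose 2) + p\<close>, and \<open>r < p\<close>.\<close>
  then have "card (edges G) < (p + 1) choose 2"
    using assms(4) by (simp add: numeral_2_eq_2)
  then have "Mad G < real p" using Mad_less_of_card_edges[OF assms(1,2)] by blast
  ultimately show ?thesis by linarith
qed

text \<open>Complete members satisfy \<open>Mad \<le> \<omega> - 1\<close>. At most one member is
  exceptional, and its \<open>Mad\<close> exceeds \<open>\<omega> - 1\<close> by less than 1; this
  is the final summand 1.\<close>

lemma packing_Mad_sum_less:
  fixes n k p q r :: nat
  assumes "n \<ge> 1" "r < p"
    and "(\<exists>G. type1_packing k n p q r G \<and> (\<Sum>i<k. Mad (G i)) = M) \<or>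
       (\<exists>G j. type2_packing k n p q r G j \<and> (\<Sum>i<k. Mad (G i)) = M \<and>
              (real r \<ge> (real p - 1) / 2 \<longrightarrow> clique_number (drop_isolated (G j)) = p))"
  obtains G where "edge_partition k n G" "M < (\<Sum>i<k. real (clique_number (G i)) - 1) + 1"
proof -
  have "{..<n} \<noteq> {}" using assms(1) by (simp add: lessThan_empty_iff)
  show thesis
    using assms(3)
  proof (elim disjE exE conjE)
    fix G assume G: "type1_packing k n p q r G" "(\<Sum>i<k. Mad (G i)) = M"
    have part: "edge_partition k n G" using G by (simp add: type1_packing_def)
    note member = edge_partition_member[OF part]
    obtain Q where copies: "\<forall>i\<in>Q. copy_of_complete (p + 1) (drop_isolated (G i))"
      "\<forall>i\<in>{..<k} - Q. copy_of_complete p (drop_isolated (G i))"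
      using G(1) unfolding type1_packing_def by blast
    have "Mad (G i) \<le> real (clique_number (G i)) - 1" if "i < k" for i
    proof -
      \<comment> \<open>Here \<open>m\<close> is \<open>p + 1\<close> or \<open>p\<close>, and
        \<open>p\<close> is positive because \<open>r < p\<close>.\<close>
      have "\<exists>m\<ge>1. copy_of_complete m (drop_isolated (G i))"
        using copies that assms(2) by (cases "i \<in> Q") (auto intro: exI[of _ "p + 1"] exI[of _ p])
      then show ?thesis
        using Mad_le_clique_number_of_copy[of "G i"] member[of i] that \<open>{..<n} \<noteq> {}\<close> by auto
    qed
    then have "(\<Sum>i<k. Mad (G i)) \<le> (\<Sum>i<k. real (clique_number (G i)) - 1)"
      by (intro sum_mono) simp
    then show thesis using that[OF part] G(2) by linarith
  next
    fix G j assume G: "type2_packing k n p q r G j" "(\<Sum>i<k. Mad (G i)) = M"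
      and cl: "real r \<ge> (real p - 1) / 2 \<longrightarrow> clique_number (drop_isolated (G j)) = p"
    have part: "edge_partition k n G" and j: "j < k" using G by (simp_all add: type2_packing_def)
    obtain Q where copies: "\<forall>i\<in>Q. copy_of_complete (p + 1) (drop_isolated (G i))"
      "\<forall>i\<in>{..<k} - {j} - Q. copy_of_complete p (drop_isolated (G i))"
      using G(1) unfolding type2_packing_def by blast
    note member = edge_partition_member[OF part]
    have "Mad (G i) \<le> real (clique_number (G i)) - 1" if "i \<in> {..<k} - {j}" for i
    proof -
      have "\<exists>m\<ge>1. copy_of_complete m (drop_isolated (G i))"
        using copies that assms(2) by (cases "i \<in> Q") (auto intro: exI[of _ "p + 1"] exI[of _ p])
      then show ?thesis
        using Mad_le_clique_number_of_copy[of "G i"] member[of i] that \<open>{..<n} \<noteq> {}\<close> by auto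
    qed
    then have "(\<Sum>i\<in>{..<k} - {j}. Mad (G i)) \<le> (\<Sum>i\<in>{..<k} - {j}. real (clique_number (G i)) - 1)"
      by (intro sum_mono)
    moreover have "Mad (G j) < real (clique_number (G j))"
      using Mad_less_clique_number_of_F_family[of "G j" p r] member[OF j] \<open>{..<n} \<noteq> {}\<close> G(1) cl
        assms(2) by (simp add: type2_packing_def)
    ultimately have "(\<Sum>i<k. Mad (G i)) < (\<Sum>i<k. real (clique_number (G i)) - 1) + 1"
      using j by (simp add: sum.remove[of "{..<k}" j])
    then show thesis using that[OF part] G(2) by simp
  qed
qed

section \<open>Evaluation of all seven parameters on one packing\<close>

theorem theorem7p3:
  fixes n k p q r :: nat
  assumes "n \<ge> 3" and "2 \<le> k" and "k \<le> n choose 2"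
    and "k * (p choose 2) \<le> n choose 2" and "n choose 2 < k * ((p + 1) choose 2)"
    and "n choose 2 = k * (p choose 2) + q * p + r"
    and "q < k" and "r < p"
    and attained:
      "(\<exists>G. type1_packing k n p q r G \<and> (\<Sum>i<k. Mad (G i)) = param_max Mad k n) \<or>
       (\<exists>G j. type2_packing k n p q r G j \<and> (\<Sum>i<k. Mad (G i)) = param_max Mad k n \<and>
              (real r \<ge> (real p - 1) / 2 \<longrightarrow> clique_number (drop_isolated (G j)) = p))"
  shows "(param_max clique_number k n = param_max chromatic_number k n \<and>
          param_max chromatic_number k n = param_max choice_number k n \<and>
          param_max choice_number k n = param_max coloring_number k n \<and>
          int (param_max coloring_number k n) = \<lfloor>param_max Mad k n\<rfloor> + int k) \<and>
         (param_max kappa_star k n = param_max lambda_star k n \<and>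
          param_max lambda_star k n = param_max degeneracy k n \<and>
          int (param_max degeneracy k n) = \<lfloor>param_max Mad k n\<rfloor>)"
proof -
  obtain G where part: "edge_partition k n G"
    and less: "param_max Mad k n < (\<Sum>i<k. real (clique_number (G i)) - 1) + 1"
    by (rule packing_Mad_sum_less[OF _ \<open>r < p\<close> attained]) (use assms(1) in auto)
  have mem: "fin_graph (H i)" "verts (H i) \<noteq> {}" if "edge_partition k n H" "i < k" for H i
    using edge_partition_member[OF that] assms(1) by (auto simp: lessThan_empty_iff)
  \<comment> \<open>The integer \<open>b\<close> turns out to be the floor of \<open>M(k,n)\<close>:
    it is at most \<open>M(k,n)\<close> by \<open>deg_le\<close>, and \<open>M(k,n) < b + 1\<close>
    because the sum of \<open>\<omega> - 1\<close> over \<open>G\<close> is at most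
    \<open>b\<close>.\<close>
  define b where "b = (\<Sum>i<k. degeneracy (G i))"
  have deg_le: "real (\<Sum>i<k. degeneracy (H i)) \<le> param_max Mad k n"
    if H: "edge_partition k n H" for H
  proof -
    have "real (\<Sum>i<k. degeneracy (H i)) \<le> (\<Sum>i<k. Mad (H i))"
      unfolding of_nat_sum using mem[OF H] by (intro sum_mono degeneracy_le_Mad) auto
    also have "\<dots> \<le> param_max Mad k n" using H by (rule param_max_ge)
    finally show ?thesis .
  qed
  have "(\<Sum>i<k. real (clique_number (G i)) - 1) \<le> (\<Sum>i<k. real (degeneracy (G i)))"
    using clique_number_le_kappa_star[OF mem[OF part]] kappa_star_le_degeneracy[OF mem[OF part]]
    by (intro sum_mono) fastforce
  then have floor: "\<lfloor>param_max Mad k n\<rfloor> = int b"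
    using less deg_le[OF part] by (intro floor_unique) (auto simp: b_def)
  \<comment> \<open>An integer bounded by \<open>M(k,n)\<close> is bounded by its floor.\<close>
  have deg_b: "(\<Sum>i<k. degeneracy (H i)) \<le> b" if "edge_partition k n H" for H
    using deg_le[OF that] floor by (metis le_floor_iff of_int_of_nat_eq of_nat_le_iff)
  have "int b < (\<Sum>i<k. real (clique_number (G i)) - 1) + 1"
    using less floor by linarith
  \<comment> \<open>The \<open>k\<close> subtracted ones move to the left. Both sides are then
    integers, so the strict inequality absorbs the 1 on the right.\<close>
  then have "real (b + k) < real ((\<Sum>i<k. clique_number (G i)) + 1)"
    by (simp add: sum_subtractf)
  then have clique_ge: "b + k \<le> (\<Sum>i<k. clique_number (G i))"
    by (simp only: of_nat_less_iff)
  \<comment> \<open>Any parameter between \<open>\<omega> - 1\<close> and the degeneracy is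
    squeezed: \<open>G\<close> gives at least \<open>b\<close> by \<open>clique_ge\<close>, and
    every partition gives at most \<open>b\<close> by \<open>deg_b\<close>.\<close>
  have star: "param_max f k n = b"
    if "\<And>H. fin_graph H \<Longrightarrow> verts H \<noteq> {} \<Longrightarrow> clique_number H \<le> f H + 1"
      and "\<And>H. fin_graph H \<Longrightarrow> verts H \<noteq> {} \<Longrightarrow> f H \<le> degeneracy H" for f :: "nat graph \<Rightarrow> nat"
  proof (rule param_max_eqI[OF part])
    have "(\<Sum>i<k. clique_number (G i)) \<le> (\<Sum>i<k. f (G i) + 1)"
      using that(1) mem[OF part] by (intro sum_mono) auto
    then show "b \<le> (\<Sum>i<k. f (G i))" using clique_ge by (simp add: sum.distrib sum_Suc)
    fix H assume H: "edge_partition k n H"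
    have "(\<Sum>i<k. f (H i)) \<le> (\<Sum>i<k. degeneracy (H i))"
      using that(2) mem[OF H] by (intro sum_mono) auto
    then show "(\<Sum>i<k. f (H i)) \<le> b" using deg_b[OF H] by linarith
  qed
  \<comment> \<open>The same squeeze between \<open>\<omega>\<close> and
    \<open>coloring_number\<close>; the extra 1 in each of the \<open>k\<close> members accounts for
    the shift by \<open>k\<close>.\<close>
  have colour: "param_max f k n = b + k"
    if "\<And>H. fin_graph H \<Longrightarrow> clique_number H \<le> f H"
      and "\<And>H. fin_graph H \<Longrightarrow> verts H \<noteq> {} \<Longrightarrow> f H \<le> coloring_number H" for f :: "nat graph \<Rightarrow> nat"
  proof (rule param_max_eqI[OF part])
    have "(\<Sum>i<k. clique_number (G i)) \<le> (\<Sum>i<k. f (G i))"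
      using that(1) mem[OF part] by (intro sum_mono) auto
    then show "b + k \<le> (\<Sum>i<k. f (G i))" using clique_ge by linarith
    fix H assume H: "edge_partition k n H"
    have "(\<Sum>i<k. f (H i)) \<le> (\<Sum>i<k. coloring_number (H i))"
      using that(2) mem[OF H] by (intro sum_mono) auto
    also have "\<dots> = (\<Sum>i<k. degeneracy (H i)) + k"
      by (simp add: coloring_number_def sum_Suc)
    finally show "(\<Sum>i<k. f (H i)) \<le> b + k" using deg_b[OF H] by linarith
  qed
  note chain = clique_number_le_chromatic_number chromatic_number_le_choice_number
    choice_number_le_coloring_number
  have "param_max clique_number k n = b + k" "param_max chromatic_number k n = b + k"
    "param_max choice_number k n = b + k" "param_max coloring_number k n = b + k"
    by (rule colour; blast intro: chain order.trans)+
  moreover have "param_max kappa_star k n = b"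
    by (rule star) (simp_all add: clique_number_le_kappa_star[simplified] kappa_star_le_degeneracy)
  moreover have "param_max lambda_star k n = b"
    by (rule star) (simp_all add: clique_number_le_lambda_star[simplified] lambda_star_le_degeneracy)
  \<comment> \<open>The clique bound for the degeneracy itself is obtained through
    \<open>kappa_star\<close>.\<close>
  moreover have "param_max degeneracy k n = b"
    using clique_number_le_kappa_star kappa_star_le_degeneracy
    by (intro star) (fastforce intro: order.trans)+
  ultimately show ?thesis using floor by simp
qed

end
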